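(* Let $\alpha>-1$. For every integer $n\ge 0$, the homogeneous $q$-Laguerre polynomial $L_n^{(\alpha)}(x,y)$ satisfies the $q$-partial differential equation $$\mathcal{D}_{q,x}(1-q^{\alpha}\eta_x)\bigl\{L_n^{(\alpha)}(x,y)\bigr\}=-q^{\alpha+1}\eta_x^2\,\mathcal{D}_{q,y}\bigl\{L_n^{(\alpha)}(x,y)\bigr\},$$ that is, $$\mathcal{D}_{q,x}\bigl\{L_n^{(\alpha)}(x,y)-q^{\alpha}L_n^{(\alpha)}(qx,y)\bigr\}=-q^{\alpha+1}\mathcal{D}_{q,y}\bigl\{L_n^{(\alpha)}(q^2x,y)\bigr\}.$$
   Context: Fix $q$ with $0<|q|<1$; real powers $q^{s}$ are taken with respect to a fixed choice of $\log q$. $(a;q)_0=1$, $(a;q)_n=\prod_{i=0}^{n-1}(1-aq^i)$, and $\begin{bmatrix} n\\ k\end{bmatrix}=\frac{(q;q)_n}{(q;q)_k(q;q)_{n-k}}$. The homogeneous $q$-Laguerre polynomials are $$L_n^{(\alpha)}(x,y)=\sum_{k=0}^n\begin{bmatrix} n\\ k\end{bmatrix}\frac{q^{k^2+k\alpha}}{(q^{\alpha+1};q)_k}(-x)^k y^{n-k}.$$ The $q$-partial derivative in a variable $x$ (other variables held constant) is $\mathcal{D}_{q,x}\{f\}=\frac{f(x)-f(qx)}{x}$ (for polynomials extended to $x=0$ in the obvious way). The $q$-shift operator $\eta_x^r$ replaces $x$ by $q^r x$. A product of operators is composition. *)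

theory Defs
  imports Complex_Main
begin

text \<open>The real powers of q depend on a chosen logarithm l of q, that is, exp l = q.
  Functions involving them take l as an argument; integer powers of q do not depend on it.\<close>

definition qpow :: "complex \<Rightarrow> real \<Rightarrow> complex" where
  "qpow l s = exp (of_real s * l)"

definition qpoch :: "complex \<Rightarrow> complex \<Rightarrow> nat \<Rightarrow> complex" where
  "qpoch a q n = (\<Prod>i<n. 1 - a * q ^ i)"

definition qbinom :: "complex \<Rightarrow> nat \<Rightarrow> nat \<Rightarrow> complex" where
  "qbinom q n k = qpoch q q n / (qpoch q q k * qpoch q q (n - k))"

definition qLaguerre :: "complex \<Rightarrow> complex \<Rightarrow> real \<Rightarrow> nat \<Rightarrow> complex \<Rightarrow> complex \<Rightarrow> complex" where
  "qLaguerre q l \<alpha> n x y =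
     (\<Sum>k\<le>n. qbinom q n k * (qpow l (real k ^ 2 + real k * \<alpha>) / qpoch (qpow l (\<alpha> + 1)) q k)
             * (- x) ^ k * y ^ (n - k))"

text \<open>At 0 the difference quotient is extended by continuity; on polynomial functions
  the limit always exists and gives the value of the quotient polynomial.\<close>

definition qderiv :: "complex \<Rightarrow> (complex \<Rightarrow> complex) \<Rightarrow> complex \<Rightarrow> complex" where
  "qderiv q f x =
     (if x = 0 then Lim (at 0) (\<lambda>t. (f t - f (q * t)) / t) else (f x - f (q * x)) / x)"

type_synonym fun2 = "complex \<Rightarrow> complex \<Rightarrow> complex"

definition qderiv_x :: "complex \<Rightarrow> fun2 \<Rightarrow> fun2" where
  "qderiv_x q F = (\<lambda>x y. qderiv q (\<lambda>t. F t y) x)"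

definition qderiv_y :: "complex \<Rightarrow> fun2 \<Rightarrow> fun2" where
  "qderiv_y q F = (\<lambda>x y. qderiv q (\<lambda>t. F x t) y)"

definition qshift_x :: "complex \<Rightarrow> real \<Rightarrow> fun2 \<Rightarrow> fun2" where
  "qshift_x l r F = (\<lambda>x y. F (qpow l r * x) y)"

text \<open>Scalar multiples and differences of operators; the identity operator is id.\<close>

definition op_scale :: "complex \<Rightarrow> (fun2 \<Rightarrow> fun2) \<Rightarrow> fun2 \<Rightarrow> fun2" where
  "op_scale c T F = (\<lambda>x y. c * T F x y)"

definition op_diff :: "(fun2 \<Rightarrow> fun2) \<Rightarrow> (fun2 \<Rightarrow> fun2) \<Rightarrow> fun2 \<Rightarrow> fun2" where
  "op_diff S T F = (\<lambda>x y. S F x y - T F x y)"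

end

theory Submission
  imports Defs
begin

text \<open>Write \<open>L\<^sub>n(x,y) = \<Sum>\<^sub>k c\<^sub>k x\<^sup>k y\<^sup>n\<^sup>-\<^sup>k\<close>. The operator on the left multiplies the
  \<open>k\<close>-th term by \<open>(1 - q\<^sup>\<alpha>\<^sup>+\<^sup>k) (1 - q\<^sup>k)\<close> and lowers the exponent of \<open>x\<close>; the one on the right
  multiplies it by \<open>- q\<^sup>\<alpha>\<^sup>+\<^sup>1 q\<^sup>2\<^sup>k (1 - q\<^sup>n\<^sup>-\<^sup>k)\<close> and lowers the exponent of \<open>y\<close>. Comparing
  coefficients, the equation is the two-term recurrence relating \<open>c\<^sub>k\<^sub>+\<^sub>1\<close> and \<open>c\<^sub>k\<close>.\<close>

text \<open>A term with exponent 0 drops out because \<open>1 - q ^ 0 = 0\<close>, so the truncated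
  \<open>e k - 1\<close> does no harm. Away from 0 the quotient is a polynomial, and continuity
  carries its value to 0. Free coefficients and exponents let the rule serve both variables.\<close>

lemma qderiv_sum_monomials:
  "qderiv q (\<lambda>t. \<Sum>k\<in>A. c k * t ^ e k) x = (\<Sum>k\<in>A. c k * (1 - q ^ e k) * x ^ (e k - 1))"
proof -
  define f where "f t = (\<Sum>k\<in>A. c k * t ^ e k)" for t
  define g where "g t = (\<Sum>k\<in>A. c k * (1 - q ^ e k) * t ^ (e k - 1))" for t
  have quot: "(f t - f (q * t)) / t = g t" if "t \<noteq> 0" for t
  proof -
    have "(c k * t ^ e k - c k * (q * t) ^ e k) / t = c k * (1 - q ^ e k) * t ^ (e k - 1)" for k
      using that by (cases "e k") (auto simp: field_simps power_mult_distrib)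
    then show ?thesis
      by (simp add: f_def g_def sum_subtractf [symmetric] sum_divide_distrib)
  qed
  have "qderiv q f x = g x"
  proof (cases "x = 0")
    case True
    have "isCont g 0"
      unfolding g_def by (intro continuous_intros)
    then have "g \<midarrow>0\<rightarrow> g 0"
      by (simp add: isCont_def)
    moreover have "eventually (\<lambda>t. g t = (f t - f (q * t)) / t) (at 0)"
      using quot by (auto simp: eventually_at_filter)
    ultimately have "(\<lambda>t. (f t - f (q * t)) / t) \<midarrow>0\<rightarrow> g 0"
      by (rule Lim_transform_eventually)
    then have "Lim (at 0) (\<lambda>t. (f t - f (q * t)) / t) = g 0"
      by (intro tendsto_Lim) auto
    with True show ?thesis
      by (simp add: qderiv_def)
  qed (simp add: qderiv_def quot)
  then show ?thesis
    by (simp only: f_def [abs_def] g_def)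
qed

lemma qpow_add: "qpow l (s + t) = qpow l s * qpow l t"
  by (simp add: qpow_def ring_distribs exp_add)

lemma qpow_of_nat: "qpow l (real k) = exp l ^ k"
  by (simp add: qpow_def exp_of_nat_mult)

lemma norm_qpow_less_1:
  assumes "norm (exp l) < 1" and "s > 0"
  shows "norm (qpow l s) < 1"
  using assms by (simp add: qpow_def mult_pos_neg)

lemma qpoch_Suc: "qpoch a q (Suc n) = qpoch a q n * (1 - a * q ^ n)"
  by (simp add: qpoch_def)

lemma qpoch_nonzero:
  assumes "norm a < 1" and "norm q < 1"
  shows "qpoch a q n \<noteq> 0"
proof -
  have "norm (a * q ^ i) < 1" for i
  proof -
    have "norm a * norm q ^ i \<le> norm a"
      using assms by (intro mult_left_le power_le_one) auto
    with assms show ?thesis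
      by (simp add: norm_mult norm_power)
  qed
  then have "1 - a * q ^ i \<noteq> 0" for i
    by (metis eq_iff_diff_eq_0 norm_one less_irrefl)
  then show ?thesis
    by (simp add: qpoch_def)
qed

text \<open>Each extra factor cancels the last factor of one denominator, leaving
  \<open>qpoch q q n / (qpoch q q k * qpoch q q (n - Suc k))\<close> on both sides.\<close>

lemma qbinom_Suc:
  assumes "norm q < 1" and "k < n"
  shows "qbinom q n (Suc k) * (1 - q ^ Suc k) = qbinom q n k * (1 - q ^ (n - k))"
proof -
  have nz: "qpoch q q j \<noteq> 0" for j
    using assms by (intro qpoch_nonzero) auto
  have nk: "n - k = Suc (n - Suc k)"
    using assms by simp
  have "1 - q ^ Suc k \<noteq> 0" "1 - q ^ (n - k) \<noteq> 0"
    using nz [of "Suc k"] nz [of "n - k"] by (auto simp: nk qpoch_Suc)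
  moreover have eqs: "qpoch q q (Suc k) = qpoch q q k * (1 - q ^ Suc k)"
    "qpoch q q (n - k) = qpoch q q (n - Suc k) * (1 - q ^ (n - k))"
    by (simp_all add: nk qpoch_Suc)
  ultimately show ?thesis
    using nz [of k] nz [of "n - Suc k"] unfolding qbinom_def eqs
    by (simp del: power_Suc)
qed

text \<open>The sign is absorbed here so that plain powers of \<open>x\<close> remain to be
  differentiated.\<close>

definition qLaguerre_coeff :: "complex \<Rightarrow> complex \<Rightarrow> real \<Rightarrow> nat \<Rightarrow> nat \<Rightarrow> complex" where
  "qLaguerre_coeff q l \<alpha> n k =
     qbinom q n k * (qpow l (real k ^ 2 + real k * \<alpha>) / qpoch (qpow l (\<alpha> + 1)) q k) * (-1) ^ k"

lemma qLaguerre_eq_sum_coeff: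
  "qLaguerre q l \<alpha> n x y = (\<Sum>k\<le>n. qLaguerre_coeff q l \<alpha> n k * x ^ k * y ^ (n - k))"
  unfolding qLaguerre_def qLaguerre_coeff_def
  by (intro sum.cong refl, subst power_minus) (simp add: mult_ac)

text \<open>Three ratios combine: \<open>qbinom_Suc\<close> for the binomials, the factor
  \<open>a * q ^ (2 * k)\<close> from the quadratic exponent, and the new factor of the denominator,
  which cancels. As \<alpha> > -1 gives \<open>norm a < 1\<close>, no denominator vanishes.\<close>

lemma qLaguerre_coeff_Suc:
  assumes "norm q < 1" and "exp l = q" and "\<alpha> > -1" and "k < n"
  shows "qLaguerre_coeff q l \<alpha> n (Suc k) * (1 - qpow l \<alpha> * q ^ Suc k) * (1 - q ^ Suc k) =
         - qpow l (\<alpha> + 1) * q ^ (2 * k) * qLaguerre_coeff q l \<alpha> n k * (1 - q ^ (n - k))"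
proof -
  define a where "a = qpow l (\<alpha> + 1)"
  have "norm a < 1"
    unfolding a_def using assms by (intro norm_qpow_less_1) auto
  then have nz: "qpoch a q j \<noteq> 0" for j
    using assms by (intro qpoch_nonzero) auto
  \<comment> \<open>This identifies the multiplier coming from the operator with the last factor of
    \<open>qpoch a q (Suc k)\<close>.\<close>
  have a_eq: "qpow l \<alpha> * q ^ Suc k = a * q ^ k"
    using qpow_of_nat [of l 1] assms by (simp add: a_def qpow_add)
  have expnt: "real (Suc k) ^ 2 + real (Suc k) * \<alpha> =
      (real k ^ 2 + real k * \<alpha>) + ((\<alpha> + 1) + real (2 * k))"
    by (simp add: power2_eq_square algebra_simps)
  have pow: "qpow l (real (Suc k) ^ 2 + real (Suc k) * \<alpha>) =
      qpow l (real k ^ 2 + real k * \<alpha>) * (a * q ^ (2 * k))"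
    unfolding expnt using assms(2) by (simp only: qpow_add qpow_of_nat a_def)
  define P where "P = qpow l (real k ^ 2 + real k * \<alpha>)"
  have nz': "1 - a * q ^ k \<noteq> 0"
    using nz [of "Suc k"] by (simp add: qpoch_Suc)
  have "qLaguerre_coeff q l \<alpha> n (Suc k) * (1 - a * q ^ k) * (1 - q ^ Suc k) =
      (qbinom q n (Suc k) * (1 - q ^ Suc k)) *
      (P * (a * q ^ (2 * k)) / (qpoch a q k * (1 - a * q ^ k))) * (1 - a * q ^ k) * (-1) ^ Suc k"
    unfolding qLaguerre_coeff_def pow a_def [symmetric] P_def [symmetric] qpoch_Suc
    by (simp only: mult_ac)
  also have "\<dots> = (qbinom q n k * (1 - q ^ (n - k))) *
      (P * (a * q ^ (2 * k)) / qpoch a q k) * (-1) ^ Suc k"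
    using nz' assms by (simp add: qbinom_Suc del: power_Suc)
  also have "\<dots> = - a * q ^ (2 * k) * qLaguerre_coeff q l \<alpha> n k * (1 - q ^ (n - k))"
    unfolding qLaguerre_coeff_def a_def [symmetric] P_def [symmetric]
    by (simp add: mult_ac)
  finally show ?thesis
    by (simp only: a_eq a_def)
qed

text \<open>Replacing \<open>t\<close> by \<open>q * t\<close> scales the \<open>k\<close>-th
  monomial by \<open>q ^ k\<close>, so the difference only rescales coefficients.\<close>

lemma qLaguerre_qderiv_x:
  "qderiv q (\<lambda>t. qLaguerre q l \<alpha> n t y - b * qLaguerre q l \<alpha> n (q * t) y) x =
   (\<Sum>k\<le>n. qLaguerre_coeff q l \<alpha> n k * (1 - b * q ^ k) * (1 - q ^ k) * x ^ (k - 1) * y ^ (n - k))"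
proof -
  have "(\<lambda>t. qLaguerre q l \<alpha> n t y - b * qLaguerre q l \<alpha> n (q * t) y) =
      (\<lambda>t. \<Sum>k\<le>n. (qLaguerre_coeff q l \<alpha> n k * (1 - b * q ^ k) * y ^ (n - k)) * t ^ k)"
    unfolding qLaguerre_eq_sum_coeff sum_distrib_left sum_subtractf [symmetric]
    by (intro ext sum.cong refl) (simp add: algebra_simps)
  then show ?thesis
    by (simp only: qderiv_sum_monomials) (simp only: mult_ac)
qed

lemma qLaguerre_qderiv_y:
  "qderiv q (\<lambda>t. qLaguerre q l \<alpha> n x t) y =
   (\<Sum>k\<le>n. qLaguerre_coeff q l \<alpha> n k * x ^ k * (1 - q ^ (n - k)) * y ^ (n - k - 1))"
  unfolding qLaguerre_eq_sum_coeff by (rule qderiv_sum_monomials)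

lemma qLaguerre_qderiv_eq:
  assumes "norm q < 1" and "exp l = q" and "\<alpha> > -1"
  shows "qderiv q (\<lambda>t. qLaguerre q l \<alpha> n t y - qpow l \<alpha> * qLaguerre q l \<alpha> n (q * t) y) x =
         - qpow l (\<alpha> + 1) * qderiv q (\<lambda>t. qLaguerre q l \<alpha> n (q ^ 2 * x) t) y"
proof (cases n)
  case 0
  then show ?thesis
    by (simp only: qLaguerre_qderiv_x qLaguerre_qderiv_y) simp
next
  case (Suc m)
  let ?c = "qLaguerre_coeff q l \<alpha> n"
  \<comment> \<open>The term at \<open>k = 0\<close> vanishes through \<open>1 - q ^ 0\<close>, so
    the index can be shifted down by one.\<close>
  have "(\<Sum>k\<le>n. ?c k * (1 - qpow l \<alpha> * q ^ k) * (1 - q ^ k) * x ^ (k - 1) * y ^ (n - k)) =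
      (\<Sum>k\<le>m. (?c (Suc k) * (1 - qpow l \<alpha> * q ^ Suc k) * (1 - q ^ Suc k)) * x ^ k * y ^ (m - k))"
    unfolding Suc sum.atMost_Suc_shift by simp
  also have "\<dots> = (\<Sum>k\<le>m. (- qpow l (\<alpha> + 1) * q ^ (2 * k) * ?c k * (1 - q ^ (n - k)))
      * x ^ k * y ^ (m - k))"
    using Suc by (intro sum.cong refl arg_cong2 [where f = "(*)"] qLaguerre_coeff_Suc assms) auto
  also have "\<dots> = - qpow l (\<alpha> + 1) *
      (\<Sum>k\<le>m. ?c k * (q ^ 2 * x) ^ k * (1 - q ^ (n - k)) * y ^ (m - k))"
    unfolding sum_distrib_left
    by (intro sum.cong refl) (simp add: power_mult_distrib mult_ac flip: power_mult)
  \<comment> \<open>The added term \<open>k = n\<close> vanishes through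
    \<open>1 - q ^ (n - k)\<close>; for the others \<open>n - k - 1 = m - k\<close>.\<close>
  also have "(\<Sum>k\<le>m. ?c k * (q ^ 2 * x) ^ k * (1 - q ^ (n - k)) * y ^ (m - k)) =
      (\<Sum>k\<le>n. ?c k * (q ^ 2 * x) ^ k * (1 - q ^ (n - k)) * y ^ (n - k - 1))"
    unfolding Suc sum.atMost_Suc by (simp del: power_Suc)
  finally show ?thesis
    unfolding qLaguerre_qderiv_x qLaguerre_qderiv_y .
qed

theorem proposition2p1:
  fixes q l :: complex and \<alpha> :: real and n :: nat
  assumes "0 < norm q" and "norm q < 1"
    and "exp l = q"
    and "\<alpha> > -1"
  shows "(qderiv_x q \<circ> op_diff id (op_scale (qpow l \<alpha>) (qshift_x l 1))) (qLaguerre q l \<alpha> n)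
           = op_scale (- qpow l (\<alpha> + 1)) (qshift_x l 2 \<circ> qderiv_y q) (qLaguerre q l \<alpha> n)
       \<and> (\<forall>x y. qderiv q (\<lambda>t. qLaguerre q l \<alpha> n t y - qpow l \<alpha> * qLaguerre q l \<alpha> n (q * t) y) x
           = - qpow l (\<alpha> + 1) * qderiv q (\<lambda>t. qLaguerre q l \<alpha> n (q ^ 2 * x) t) y)"
proof -
  \<comment> \<open>At the integer shifts 1 and 2 the chosen logarithm no longer matters, so the
    operator form unfolds to the explicit one.\<close>
  have "qpow l 1 = q" "qpow l 2 = q ^ 2"
    using qpow_of_nat [of l 1] qpow_of_nat [of l 2] assms(3) by simp_all
  then show ?thesis
    using qLaguerre_qderiv_eq [OF assms(2-4)]
    by (simp add: fun_eq_iff qderiv_x_def qderiv_y_def op_diff_def op_scale_def qshift_x_def)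
qed

end
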